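(* Let $m,n\in\mathbb{N}$ with $m\geq 2$ and let $A,B\in M_n$. Then $\mathcal{K}_m(A)$ and $\mathcal{K}_m(B)$ are similar if and only if $N_k^A=N_k^B$ for each $k\in\{1,\ldots,m\}$.
   Context: $M_n$ is the set of $n\times n$ complex matrices. For $A\in M_n$ and $m\ge 2$, the block upper triangular KMS matrix $\mathcal{K}_m(A)$ is the $mn\times mn$ matrix whose $(i,j)$ block ($n\times n$, $1\le i,j\le m$) is $A^{j-i}$ if $j>i$ and $0$ if $j\le i$. $J_k(0)$ denotes the $k\times k$ upper triangular nilpotent Jordan block and $\otimes$ the Kronecker product $X\otimes Y=[x_{ij}Y]$. For $Z\in M_n$ and $k\in\{1,\ldots,m\}$ (with $m$ fixed), $N_k^Z$ denotes the number of $J_k(0)$ blocks in the Jordan canonical form of $J_m(0)\otimes Z$. *)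

theory Defs
  imports
    Complex_Main
    "Jordan_Normal_Form.Jordan_Normal_Form_Existence"
    "Jordan_Normal_Form.Jordan_Normal_Form_Uniqueness"
begin

text \<open>Matrices are indexed from 0: for \<open>r < n\<close>, row \<open>i * n + r\<close> of a matrix cut into
  \<open>n \<times> n\<close> blocks is row \<open>r\<close> of the (0-based) block row \<open>i\<close>, and likewise for columns.\<close>

definition kronecker_mat :: "'a::semiring_1 mat \<Rightarrow> 'a mat \<Rightarrow> 'a mat" where
  "kronecker_mat X Y = mat (dim_row X * dim_row Y) (dim_col X * dim_col Y)
     (\<lambda>(i, j). X $$ (i div dim_row Y, j div dim_col Y) * Y $$ (i mod dim_row Y, j mod dim_col Y))"

text \<open>\<open>KMS_mat m A\<close> is meant for square \<open>A\<close>.\<close>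

definition KMS_mat :: "nat \<Rightarrow> 'a::semiring_1 mat \<Rightarrow> 'a mat" where
  "KMS_mat m A = (let n = dim_row A in mat (m * n) (m * n)
     (\<lambda>(i, j). if i div n < j div n
               then (A ^\<^sub>m (j div n - i div n)) $$ (i mod n, j mod n) else 0))"

text \<open>A Jordan normal form in the library is a list of pairs (block size, eigenvalue); it is
  unique only up to reordering. The description below is proper by
  \<open>num_jordan_blocks_eq\<close> and \<open>complex_jordan_nf_exists\<close>.\<close>

definition num_jordan_blocks :: "complex mat \<Rightarrow> nat \<Rightarrow> complex \<Rightarrow> nat" where
  "num_jordan_blocks M k a =
     (THE c. \<exists>n_as. jordan_nf M n_as \<and> c = count_list n_as (k, a))"

text \<open>\<open>num_nilpotent_blocks m Z k\<close> is \<open>N_k^Z\<close> for the given \<open>m\<close>.\<close>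

definition num_nilpotent_blocks :: "nat \<Rightarrow> complex mat \<Rightarrow> nat \<Rightarrow> nat" where
  "num_nilpotent_blocks m Z k =
     num_jordan_blocks (kronecker_mat (jordan_block m 0) Z) k 0"

lemma kronecker_mat_carrier:
  assumes "X \<in> carrier_mat p q" "Y \<in> carrier_mat r s"
  shows "kronecker_mat X Y \<in> carrier_mat (p * r) (q * s)"
  using assms by (auto simp: kronecker_mat_def)

lemma KMS_mat_carrier:
  assumes "A \<in> carrier_mat n n"
  shows "KMS_mat m A \<in> carrier_mat (m * n) (m * n)"
  using assms by (auto simp: KMS_mat_def Let_def)

lemma block_index_less:
  fixes i r m n :: nat
  assumes "i < m" "r < n"
  shows "i * n + r < m * n"
proof -
  have "i * n + r < Suc i * n" using assms(2) by simp
  also have "\<dots> \<le> m * n" using assms(1) by (intro mult_le_mono1) simp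
  finally show ?thesis .
qed

lemma kronecker_mat_block:
  assumes "X \<in> carrier_mat p q" "Y \<in> carrier_mat n l" "i < p" "j < q" "r < n" "s < l"
  shows "kronecker_mat X Y $$ (i * n + r, j * l + s) = X $$ (i, j) * Y $$ (r, s)"
  using assms block_index_less[of i p r n] block_index_less[of j q s l]
  by (auto simp: kronecker_mat_def)

lemma KMS_mat_block:
  assumes "A \<in> carrier_mat n n" "i < m" "j < m" "r < n" "s < n"
  shows "KMS_mat m A $$ (i * n + r, j * n + s) =
    (if i < j then (A ^\<^sub>m (j - i)) $$ (r, s) else 0)"
  using assms block_index_less[of i m r n] block_index_less[of j m s n]
  by (auto simp: KMS_mat_def Let_def)

lemma complex_jordan_nf_exists:
  fixes M :: "complex mat"
  assumes "M \<in> carrier_mat n n"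
  shows "\<exists>n_as. jordan_nf M n_as"
  using char_poly_factorized[OF assms] jordan_nf_exists[OF assms] by blast

lemma num_jordan_blocks_eq:
  assumes "jordan_nf M n_as"
  shows "num_jordan_blocks M k a = count_list n_as (k, a)"
proof -
  have len: "length (filter ((=) x) xs) = count_list xs x" for x :: "nat \<times> complex" and xs
    by (induct xs) auto
  have "count_list bs (k, a) = count_list n_as (k, a)" if bs: "jordan_nf M bs" for bs
  proof (cases "k = 0")
    case True
    have "(0, a) \<notin> set xs" if "jordan_nf M xs" for xs
      using that unfolding jordan_nf_def by force
    with True bs assms show ?thesis by simp
  next
    case False
    with bs assms show ?thesis
      using compute_nr_of_jordan_blocks[of M bs k a] compute_nr_of_jordan_blocks[of M n_as k a]
      by (simp add: len)
  qed
  note unique = this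
  show ?thesis
    unfolding num_jordan_blocks_def
  proof (rule the_equality)
    show "\<exists>bs. jordan_nf M bs \<and> count_list n_as (k, a) = count_list bs (k, a)"
      using assms by blast
  next
    fix c
    assume "\<exists>bs. jordan_nf M bs \<and> c = count_list bs (k, a)"
    then show "c = count_list n_as (k, a)" by (elim exE conjE) (metis unique)
  qed
qed

end

theory Submission
  imports Defs "HOL-Library.Multiset"
begin

text \<open>Write \<open>N = J\<^sub>m(0) \<otimes> A\<close> and \<open>K = \<K>\<^sub>m(A)\<close>. Blockwise \<open>K = N + N\<^sup>2 + \<dots> + N\<^sup>m\<^sup>-\<^sup>1\<close>,
  equivalently \<open>K = N + N K\<close>, that is \<open>(I - N) (I + K) = I\<close>. Hence \<open>N\<close> and \<open>K\<close> determine
  each other in a way that is compatible with conjugation, so \<open>\<K>\<^sub>m(A)\<close> and \<open>\<K>\<^sub>m(B)\<close> are similar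
  iff \<open>J\<^sub>m(0) \<otimes> A\<close> and \<open>J\<^sub>m(0) \<otimes> B\<close> are. As \<open>N\<^sup>m = 0\<close>, the Jordan form of \<open>N\<close> has only
  blocks \<open>J\<^sub>k(0)\<close> with \<open>1 \<le> k \<le> m\<close>, and their numbers classify \<open>N\<close> up to similarity.\<close>

section \<open>Quasi-inverses and similarity\<close>

lemma quasi_inverse_mult_left:
  fixes N K :: "'a::field mat"
  assumes N: "N \<in> carrier_mat n n" and K: "K \<in> carrier_mat n n" and eq: "K = N + N * K"
  shows "(1\<^sub>m n - N) * (1\<^sub>m n + K) = 1\<^sub>m n"
proof -
  have "(1\<^sub>m n - N) * (1\<^sub>m n + K) = (1\<^sub>m n + K) - N * (1\<^sub>m n + K)"
    using N K by (subst minus_mult_distrib_mat[of _ n n]) auto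
  also have "N * (1\<^sub>m n + K) = N + N * K"
    using N K by (subst mult_add_distrib_mat[of _ n n]) auto
  also have "\<dots> = K" using eq by simp
  also have "(1\<^sub>m n + K) - K = 1\<^sub>m n"
    using K by (intro eq_matI) auto
  finally show ?thesis .
qed

text \<open>For square matrices over a field a one-sided inverse is two-sided. Both uniqueness
  lemmas below cancel with the factors in this order.\<close>

lemma quasi_inverse_mult_right:
  fixes N K :: "'a::field mat"
  assumes N: "N \<in> carrier_mat n n" and K: "K \<in> carrier_mat n n" and eq: "K = N + N * K"
  shows "(1\<^sub>m n + K) * (1\<^sub>m n - N) = 1\<^sub>m n"
  using N K by (intro mat_mult_left_right_inverse[OF _ _ quasi_inverse_mult_left[OF N K eq]]) auto

text \<open>Recovers \<open>N\<close> from \<open>K\<close>: multiplying \<open>N\<close> or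
  \<open>M\<close> by I + K gives \<open>K\<close>, and I + K can be cancelled on the right.\<close>

lemma quasi_inverse_unique_left:
  fixes N M K :: "'a::field mat"
  assumes N: "N \<in> carrier_mat n n" and M: "M \<in> carrier_mat n n" and K: "K \<in> carrier_mat n n"
    and eqN: "K = N + N * K" and eqM: "K = M + M * K"
  shows "M = N"
proof -
  have expand: "X * (1\<^sub>m n + K) = X + X * K" if "X \<in> carrier_mat n n" for X
    using that K by (subst mult_add_distrib_mat[of _ n n]) auto
  have cancel: "X * (1\<^sub>m n + K) * (1\<^sub>m n - N) = X" if "X \<in> carrier_mat n n" for X
    using that N K quasi_inverse_mult_right[OF N K eqN]
    by (subst assoc_mult_mat[of _ n n _ n _ n]) auto
  have "M * (1\<^sub>m n + K) = N * (1\<^sub>m n + K)"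
    unfolding expand[OF M] expand[OF N] using eqN eqM by simp
  then show ?thesis using cancel[OF M] cancel[OF N] by metis
qed

text \<open>Recovers \<open>K\<close> from \<open>N\<close>: both solutions X satisfy (I - N) X = N,
  and I - N can be cancelled on the left.\<close>

lemma quasi_inverse_unique_right:
  fixes N K L :: "'a::field mat"
  assumes N: "N \<in> carrier_mat n n" and K: "K \<in> carrier_mat n n" and L: "L \<in> carrier_mat n n"
    and eqK: "K = N + N * K" and eqL: "L = N + N * L"
  shows "L = K"
proof -
  have expand: "(1\<^sub>m n - N) * X = N" if X: "X \<in> carrier_mat n n" and eq: "X = N + N * X" for X
  proof -
    have "(1\<^sub>m n - N) * X = X - N * X"
      using X N by (subst minus_mult_distrib_mat[of _ n n]) auto
    also have "\<dots> = (N + N * X) - N * X" using eq by simp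
    also have "\<dots> = N" using X N by (intro eq_matI) auto
    finally show ?thesis .
  qed
  have cancel: "(1\<^sub>m n + K) * ((1\<^sub>m n - N) * X) = X" if "X \<in> carrier_mat n n" for X
    using that N K quasi_inverse_mult_right[OF N K eqK]
    by (subst assoc_mult_mat[of _ n n _ n _ n, symmetric]) auto
  show ?thesis using cancel[OF L] cancel[OF K] expand[OF L eqL] expand[OF K eqK] by metis
qed

text \<open>The map sending X to P X Q is additive, and it is multiplicative because the inner
  factor \<open>Q * P\<close> collapses; so it preserves the equation.\<close>

lemma quasi_inverse_conjugate:
  fixes N K P Q :: "'a::comm_ring_1 mat"
  assumes N: "N \<in> carrier_mat n n" and K: "K \<in> carrier_mat n n"
    and P: "P \<in> carrier_mat n n" and Q: "Q \<in> carrier_mat n n"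
    and QP: "Q * P = 1\<^sub>m n" and eq: "K = N + N * K"
  shows "P * K * Q = P * N * Q + (P * N * Q) * (P * K * Q)"
proof -
  note [simp] = assoc_mult_mat[of _ n n _ n _ n]
  have "P * N * Q * (P * K * Q) = P * N * ((Q * P) * K) * Q"
    using N K P Q by simp
  also have "\<dots> = P * (N * K) * Q" unfolding QP using N K P Q by simp
  finally have prod: "P * N * Q * (P * K * Q) = P * (N * K) * Q" .
  have "P * K * Q = P * (N + N * K) * Q" using eq by simp
  also have "\<dots> = (P * N + P * (N * K)) * Q"
    using N K P by (subst mult_add_distrib_mat[of _ n n]) auto
  also have "\<dots> = P * N * Q + P * (N * K) * Q"
    using N K P Q by (subst add_mult_distrib_mat[of _ n n]) auto
  finally show ?thesis unfolding prod .
qed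

lemma quasi_inverse_similar_iff:
  fixes N N' K K' :: "'a::field mat"
  assumes N: "N \<in> carrier_mat n n" and K: "K \<in> carrier_mat n n" and eq: "K = N + N * K"
    and N': "N' \<in> carrier_mat n n" and K': "K' \<in> carrier_mat n n" and eq': "K' = N' + N' * K'"
  shows "similar_mat K K' \<longleftrightarrow> similar_mat N N'"
proof
  assume "similar_mat K K'"
  then obtain P Q where "similar_mat_wit K K' P Q" unfolding similar_mat_def by blast
  note PQ = similar_mat_witD2[OF K this]
  \<comment> \<open>The witnesses give \<open>K = P * K' * Q\<close>, so the conjugate of
    \<open>N'\<close> solves the same equation for \<open>K\<close> as \<open>N\<close>
    does.\<close>
  have "P * N' * Q = N"
    using quasi_inverse_conjugate[OF N' K' PQ(6,7,2) eq'] N' PQ(6,7) unfolding PQ(3)[symmetric]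
    by (intro quasi_inverse_unique_left[OF N _ K eq]) auto
  with N N' PQ show "similar_mat N N'" by (intro similar_matI[of _ _ P Q n]) auto
next
  assume "similar_mat N N'"
  then obtain P Q where "similar_mat_wit N N' P Q" unfolding similar_mat_def by blast
  note PQ = similar_mat_witD2[OF N this]
  \<comment> \<open>Now \<open>N = P * N' * Q\<close>, and the conjugate of \<open>K'\<close> solves
    the equation that determines \<open>K\<close> from \<open>N\<close>.\<close>
  have "P * K' * Q = K"
    using quasi_inverse_conjugate[OF N' K' PQ(6,7,2) eq'] K' PQ(6,7) unfolding PQ(3)[symmetric]
    by (intro quasi_inverse_unique_right[OF N K _ eq]) auto
  with K K' PQ show "similar_mat K K'" by (intro similar_matI[of _ _ P Q n]) auto
qed

section \<open>Jordan matrices up to reordering of the blocks\<close>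

lemma similar_mat_four_block_swap:
  fixes A D :: "'a::comm_ring_1 mat"
  assumes A: "A \<in> carrier_mat n n" and D: "D \<in> carrier_mat m m"
  shows "similar_mat (four_block_mat A (0\<^sub>m n m) (0\<^sub>m m n) D)
    (four_block_mat D (0\<^sub>m m n) (0\<^sub>m n m) A)"
proof -
  \<comment> \<open>\<open>?P\<close> and \<open>?Q\<close> are mutually inverse block permutation
    matrices exchanging the two summands.\<close>
  let ?P = "four_block_mat (0\<^sub>m n m) (1\<^sub>m n) (1\<^sub>m m) (0\<^sub>m m n) :: 'a mat"
  let ?Q = "four_block_mat (0\<^sub>m m n) (1\<^sub>m m) (1\<^sub>m n) (0\<^sub>m n m) :: 'a mat"
  let ?M = "four_block_mat D (0\<^sub>m m n) (0\<^sub>m n m) A"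
  have PM: "?P * ?M = four_block_mat (0\<^sub>m n m) A D (0\<^sub>m m n)"
    using A D by (subst mult_four_block_mat[of _ n m _ n _ m _ _ m _ n]) auto
  have PMQ: "?P * ?M * ?Q = four_block_mat A (0\<^sub>m n m) (0\<^sub>m m n) D"
    unfolding PM using A D by (subst mult_four_block_mat[of _ n m _ n _ m _ _ n _ m]) auto
  have PQ: "?P * ?Q = 1\<^sub>m (n + m)"
    by (subst mult_four_block_mat[of _ n m _ n _ m _ _ n _ m]) auto
  have QP: "?Q * ?P = 1\<^sub>m (n + m)"
    by (subst mult_four_block_mat[of _ m n _ m _ n _ _ m _ n]) (auto simp: add.commute)
  show ?thesis
    by (rule similar_matI[OF _ PQ QP PMQ[symmetric]]) (use A D in \<open>auto simp: add.commute\<close>)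
qed

lemma jordan_matrix_append:
  fixes xs ys :: "(nat \<times> 'a::comm_ring_1) list"
  defines "p \<equiv> sum_list (map fst xs)" and "q \<equiv> sum_list (map fst ys)"
  shows "jordan_matrix (xs @ ys) =
    four_block_mat (jordan_matrix xs) (0\<^sub>m p q) (0\<^sub>m q p) (jordan_matrix ys)"
proof -
  have dim: "jordan_matrix xs \<in> carrier_mat p p" "jordan_matrix ys \<in> carrier_mat q q"
    unfolding p_def q_def by simp_all
  then show ?thesis
    unfolding jordan_matrix_def map_append diag_block_mat_append Let_def by auto
qed

lemma similar_mat_jordan_matrix_append_commute:
  fixes xs ys :: "(nat \<times> 'a::comm_ring_1) list"
  shows "similar_mat (jordan_matrix (xs @ ys)) (jordan_matrix (ys @ xs))"
  unfolding jordan_matrix_append by (rule similar_mat_four_block_swap) simp_all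

lemma similar_mat_jordan_matrix_append_cong:
  fixes xs ys xs' ys' :: "(nat \<times> 'a::comm_ring_1) list"
  assumes x: "similar_mat (jordan_matrix xs) (jordan_matrix xs')"
    and y: "similar_mat (jordan_matrix ys) (jordan_matrix ys')"
  shows "similar_mat (jordan_matrix (xs @ ys)) (jordan_matrix (xs' @ ys'))"
proof -
  \<comment> \<open>Similar matrices have equal dimensions, so the off-diagonal zero blocks on both
    sides have the same shape.\<close>
  have eq: "sum_list (map fst zs) = sum_list (map fst zs')"
    if "similar_mat (jordan_matrix zs) (jordan_matrix zs')" for zs zs' :: "(nat \<times> 'a) list"
    using similar_matD[OF that] by (metis insert_subset carrier_matD(1) jordan_matrix_dim(1))
  show ?thesis
    unfolding jordan_matrix_append eq[OF x, symmetric] eq[OF y, symmetric]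
    by (rule similar_mat_four_block_0_0[OF x y]) simp_all
qed

text \<open>A rotation of the list swaps two diagonal summands. Rotating \<open>ys\<close> brings
  the head of \<open>xs\<close> to the front, and induction handles the rest.\<close>

lemma similar_mat_jordan_matrix_mset:
  fixes xs ys :: "(nat \<times> 'a::comm_ring_1) list"
  assumes "mset xs = mset ys"
  shows "similar_mat (jordan_matrix xs) (jordan_matrix ys)"
  using assms
proof (induction xs arbitrary: ys)
  case Nil
  then show ?case by (simp add: similar_mat_refl[OF jordan_matrix_carrier])
next
  case (Cons x xs)
  have refl: "similar_mat (jordan_matrix zs) (jordan_matrix zs)" for zs :: "(nat \<times> 'a) list"
    by (rule similar_mat_refl[OF jordan_matrix_carrier])
  from Cons.prems have "x \<in> set ys" by (metis list.set_intros(1) set_mset_mset)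
  then obtain us vs where ys: "ys = us @ x # vs" by (meson split_list)
  with Cons.prems have "mset xs = mset (vs @ us)" by simp
  then have "similar_mat (jordan_matrix ([x] @ xs)) (jordan_matrix ([x] @ vs @ us))"
    by (intro similar_mat_jordan_matrix_append_cong refl Cons.IH)
  moreover have "similar_mat (jordan_matrix ([x] @ vs @ us)) (jordan_matrix ys)"
    using similar_mat_jordan_matrix_append_commute[of "[x] @ vs" us] ys by simp
  ultimately show ?case by (auto intro: similar_mat_trans)
qed

section \<open>Nilpotent matrices\<close>

text \<open>Lets nilpotency of a Jordan matrix be tested on each block separately.\<close>

lemma diag_block_mat_eq_0D:
  assumes "diag_block_mat As = 0\<^sub>m r c" and "A \<in> set As"
    and "i < dim_row A" and "j < dim_col A"
  shows "A $$ (i, j) = 0"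
  using assms
proof (induction As arbitrary: r c)
  case Nil
  then show ?case by simp
next
  case (Cons B As)
  let ?D = "diag_block_mat As"
  let ?M = "diag_block_mat (B # As)"
  have dims: "r = dim_row B + dim_row ?D" "c = dim_col B + dim_col ?D"
    using arg_cong[OF Cons.prems(1), of dim_row] arg_cong[OF Cons.prems(1), of dim_col]
    by (simp_all add: Let_def)
  have zero: "?M $$ (k, l) = 0" if "k < r" "l < c" for k l
    unfolding Cons.prems(1) using that by simp
  show ?case
  proof (cases "A = B")
    case True
    then show ?thesis using Cons.prems(3,4) zero[of i j] dims by (simp add: Let_def)
  next
    case False
    then have "A \<in> set As" using Cons.prems(2) by simp
    moreover have "?D = 0\<^sub>m (dim_row ?D) (dim_col ?D)"
    proof (rule eq_matI)
      fix k l assume "k < dim_row (0\<^sub>m (dim_row ?D) (dim_col ?D))"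
        and "l < dim_col (0\<^sub>m (dim_row ?D) (dim_col ?D))"
      then show "?D $$ (k, l) = 0\<^sub>m (dim_row ?D) (dim_col ?D) $$ (k, l)"
        using zero[of "dim_row B + k" "dim_col B + l"] dims by (simp add: Let_def)
    qed simp_all
    ultimately show ?thesis using Cons.IH Cons.prems(3,4) by blast
  qed
qed

lemma jordan_nf_nilpotent_block:
  fixes M :: "'a::field mat"
  assumes M: "M \<in> carrier_mat n n" and nil: "M ^\<^sub>m m = 0\<^sub>m n n"
    and jnf: "jordan_nf M n_as" and mem: "(k, a) \<in> set n_as"
  shows "a = 0" and "1 \<le> k" and "k \<le> m"
proof -
  let ?J = "jordan_matrix n_as"
  show k: "1 \<le> k" using jnf mem unfolding jordan_nf_def by force
  from jnf obtain P Q where wit: "similar_mat_wit M ?J P Q"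
    unfolding jordan_nf_def similar_mat_def by blast
  have "?J ^\<^sub>m m = Q * M ^\<^sub>m m * P"
    by (rule similar_mat_wit_pow_id[OF similar_mat_wit_sym[OF wit]])
  also have "\<dots> = 0\<^sub>m n n"
    unfolding nil using similar_mat_witD2(6,7)[OF M wit] by simp
  finally have "?J ^\<^sub>m m = 0\<^sub>m n n" .
  then have zero: "(jordan_block k a ^\<^sub>m m) $$ (i, j) = 0" if "i < k" "j < k" for i j
    unfolding jordan_matrix_pow using that mem
    by (intro diag_block_mat_eq_0D[where i = i and j = j]) auto
  \<comment> \<open>The diagonal entries of the power of the block are \<open>a ^ m\<close>; entry
    (0, 0) exists since \<open>k\<close> is positive.\<close>
  have "a ^ m = 0" using zero[of 0 0] k by (simp add: jordan_block_pow)
  then show a: "a = 0" by simp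
  show "k \<le> m"
  proof (rule ccontr)
    assume "\<not> k \<le> m"
    \<comment> \<open>If \<open>m < k\<close>, the m-th power of the nilpotent block still has a 1
      at position (0, m).\<close>
    then show False using zero[of 0 m] by (simp add: a jordan_block_zero_pow)
  qed
qed

text \<open>Similar matrices share a Jordan form. Conversely, nilpotency rules out all blocks except
  those counted, so equal counts make the Jordan forms equal as multisets.\<close>

lemma similar_mat_nilpotent_iff:
  fixes M M' :: "complex mat"
  assumes M: "M \<in> carrier_mat n n" and nil: "M ^\<^sub>m m = 0\<^sub>m n n"
    and M': "M' \<in> carrier_mat n n" and nil': "M' ^\<^sub>m m = 0\<^sub>m n n"
  shows "similar_mat M M' \<longleftrightarrow>
    (\<forall>k\<in>{1..m}. num_jordan_blocks M k 0 = num_jordan_blocks M' k 0)"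
proof
  assume sim: "similar_mat M M'"
  obtain n_as where jnf': "jordan_nf M' n_as" using complex_jordan_nf_exists[OF M'] by blast
  then have "jordan_nf M n_as"
    using similar_mat_trans[OF sim] unfolding jordan_nf_def by blast
  with jnf' show "\<forall>k\<in>{1..m}. num_jordan_blocks M k 0 = num_jordan_blocks M' k 0"
    by (simp add: num_jordan_blocks_eq)
next
  assume eq: "\<forall>k\<in>{1..m}. num_jordan_blocks M k 0 = num_jordan_blocks M' k 0"
  obtain xs where xs: "jordan_nf M xs" using complex_jordan_nf_exists[OF M] by blast
  obtain ys where ys: "jordan_nf M' ys" using complex_jordan_nf_exists[OF M'] by blast
  have "mset xs = mset ys"
  proof (rule multiset_eqI)
    fix p :: "nat \<times> complex"
    obtain k a where p: "p = (k, a)" by force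
    show "count (mset xs) p = count (mset ys) p"
    proof (cases "a = 0 \<and> k \<in> {1..m}")
      case True
      with eq show ?thesis
        unfolding p count_mset
        using num_jordan_blocks_eq[OF xs, of k a] num_jordan_blocks_eq[OF ys, of k a] by simp
    next
      case False
      then have "(k, a) \<notin> set xs" "(k, a) \<notin> set ys"
        using jordan_nf_nilpotent_block[OF M nil xs, of k a]
          jordan_nf_nilpotent_block[OF M' nil' ys, of k a] by auto
      then show ?thesis unfolding p by (metis count_mset_0_iff)
    qed
  qed
  then have "similar_mat (jordan_matrix xs) (jordan_matrix ys)"
    by (rule similar_mat_jordan_matrix_mset)
  with xs ys show "similar_mat M M'"
    unfolding jordan_nf_def by (blast intro: similar_mat_trans similar_mat_sym)
qed

text \<open>Matrix powers unfold with the extra factor on the right, whereas the product N K puts it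
  on the left.\<close>

lemma mult_pow_mat:
  assumes "A \<in> carrier_mat n n"
  shows "A * A ^\<^sub>m k = A ^\<^sub>m Suc k"
proof (induction k)
  case (Suc k)
  have "A * A ^\<^sub>m Suc k = A * A ^\<^sub>m k * A"
    using assms by (simp add: assoc_mult_mat[of _ n n _ n _ n])
  then show ?case unfolding Suc.IH by simp
qed (use assms in simp)

section \<open>The matrices \<open>J\<^sub>m(0) \<otimes> A\<close> and \<open>\<K>\<^sub>m(A)\<close>\<close>

context
  fixes A :: "'a::comm_ring_1 mat" and m n :: nat
  assumes A: "A \<in> carrier_mat n n"
begin

lemma kronecker_jordan_carrier:
  "kronecker_mat (jordan_block m 0) A \<in> carrier_mat (m * n) (m * n)"
  using kronecker_mat_carrier[OF jordan_block_carrier A] .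

lemma kronecker_jordan_index:
  assumes "p < m * n" and "q < m * n"
  shows "kronecker_mat (jordan_block m 0) A $$ (p, q) =
    (if q div n = Suc (p div n) then A $$ (p mod n, q mod n) else 0)"
proof -
  have "p div n < m" "q div n < m"
    using assms by (simp_all add: less_mult_imp_div_less)
  then show ?thesis using assms A by (simp add: kronecker_mat_def)
qed

text \<open>Each factor moves one block column to the right, so the k-th power lives on the k-th
  block superdiagonal.\<close>

lemma kronecker_jordan_pow_index:
  assumes "p < m * n" and "q < m * n" and "q div n \<noteq> p div n + k"
  shows "(kronecker_mat (jordan_block m 0) A ^\<^sub>m k) $$ (p, q) = 0"
  using assms(2,3)
proof (induction k arbitrary: q)
  case 0
  then have "p \<noteq> q" by auto
  then show ?case using 0 assms(1) kronecker_jordan_carrier by auto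
next
  case (Suc k)
  let ?N = "kronecker_mat (jordan_block m 0) A"
  have "(?N ^\<^sub>m Suc k) $$ (p, q) = (\<Sum>t = 0..<m * n. (?N ^\<^sub>m k) $$ (p, t) * ?N $$ (t, q))"
    using assms(1) Suc.prems kronecker_jordan_carrier pow_carrier_mat[OF kronecker_jordan_carrier, of k]
    by (auto simp: scalar_prod_def)
  also have "\<dots> = 0"
    \<comment> \<open>A nonzero term would need \<open>t div n = p div n + k\<close> and
      \<open>q div n = Suc (t div n)\<close>, contrary to the choice of \<open>q\<close>.\<close>
    using Suc by (intro sum.neutral) (auto simp: kronecker_jordan_index)
  finally show ?case .
qed

lemma kronecker_jordan_nilpotent:
  "kronecker_mat (jordan_block m 0) A ^\<^sub>m m = 0\<^sub>m (m * n) (m * n)"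
proof (rule eq_matI)
  fix p q assume "p < dim_row (0\<^sub>m (m * n) (m * n))" "q < dim_col (0\<^sub>m (m * n) (m * n))"
  then have pq: "p < m * n" "q < m * n" by auto
  \<comment> \<open>Hence no block column lies \<open>m\<close> steps to the right of
    \<open>p div n\<close>.\<close>
  then have "q div n < m" by (simp add: less_mult_imp_div_less)
  then show "(kronecker_mat (jordan_block m 0) A ^\<^sub>m m) $$ (p, q) = 0\<^sub>m (m * n) (m * n) $$ (p, q)"
    using kronecker_jordan_pow_index[OF pq, of m] pq by simp
qed (use pow_carrier_mat[OF kronecker_jordan_carrier, of m] in auto)

lemma KMS_index:
  assumes "p < m * n" and "q < m * n"
  shows "KMS_mat m A $$ (p, q) =
    (if p div n < q div n then (A ^\<^sub>m (q div n - p div n)) $$ (p mod n, q mod n) else 0)"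
  using assms A by (auto simp: KMS_mat_def Let_def)

text \<open>Left multiplication shifts the block rows up by one and multiplies them by
  \<open>A\<close>; the last block row becomes zero.\<close>

lemma kronecker_jordan_mult_index:
  assumes X: "X \<in> carrier_mat (m * n) (m * n)" and p: "p < m * n" and q: "q < m * n"
  shows "(kronecker_mat (jordan_block m 0) A * X) $$ (p, q) =
    (if Suc (p div n) < m
     then \<Sum>u<n. A $$ (p mod n, u) * X $$ (Suc (p div n) * n + u, q) else 0)"
proof -
  let ?N = "kronecker_mat (jordan_block m 0) A"
  let ?i = "Suc (p div n)"
  from p have n: "n > 0" by (cases n) auto
  have "(?N * X) $$ (p, q) = (\<Sum>t<m * n. ?N $$ (p, t) * X $$ (t, q))"
    using assms kronecker_jordan_carrier by (auto simp: scalar_prod_def atLeast0LessThan)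
  also have "\<dots> = (\<Sum>t<m * n. if t div n = ?i then A $$ (p mod n, t mod n) * X $$ (t, q) else 0)"
    using p by (intro sum.cong) (auto simp: kronecker_jordan_index)
  also have "\<dots> = (\<Sum>t | t < m * n \<and> t div n = ?i. A $$ (p mod n, t mod n) * X $$ (t, q))"
    by (subst sum.inter_filter[symmetric]) auto
  also have "\<dots> = (if ?i < m then \<Sum>u<n. A $$ (p mod n, u) * X $$ (?i * n + u, q) else 0)"
  proof (cases "?i < m")
    case True
    have "(\<Sum>t | t < m * n \<and> t div n = ?i. A $$ (p mod n, t mod n) * X $$ (t, q)) =
      (\<Sum>u<n. A $$ (p mod n, u) * X $$ (?i * n + u, q))"
    \<comment> \<open>The surviving indices are exactly the rows of block row \<open>?i\<close>,
      parametrised by their offset \<open>u\<close>.\<close>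
    proof (rule sum.reindex_bij_witness[of _ "\<lambda>u. ?i * n + u" "\<lambda>t. t mod n"])
      fix t assume t: "t \<in> {t. t < m * n \<and> t div n = ?i}"
      then have "?i * n + t mod n = t" using div_mult_mod_eq[of t n] by simp
      then show "?i * n + t mod n = t"
        and "A $$ (p mod n, t mod n) * X $$ (?i * n + t mod n, q) =
          A $$ (p mod n, t mod n) * X $$ (t, q)" by simp_all
      show "t mod n \<in> {..<n}" using n by simp
    next
      fix u assume u: "u \<in> {..<n}"
      then have "(?i * n + u) div n = ?i" and "(?i * n + u) mod n = u"
        by (simp_all only: div_mult_self3[OF n[THEN less_imp_neq, symmetric]] mod_mult_self3) auto
      then show "(?i * n + u) mod n = u"
        and "?i * n + u \<in> {t. t < m * n \<and> t div n = ?i}"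
        using block_index_less[OF True, of u n] u by simp_all
    qed
    then show ?thesis using True by simp
  next
    case False
    then have "{t. t < m * n \<and> t div n = ?i} = {}"
      using less_mult_imp_div_less by fastforce
    then show ?thesis using False by (simp only: sum.empty if_False)
  qed
  finally show ?thesis .
qed

text \<open>Multiplying by N turns each block of K into the next power of \<open>A\<close>, one
  block row higher; the first superdiagonal, which this misses, is N itself.\<close>

lemma KMS_quasi_inverse:
  "KMS_mat m A = kronecker_mat (jordan_block m 0) A + kronecker_mat (jordan_block m 0) A * KMS_mat m A"
    (is "?K = ?N + ?N * ?K")
proof (rule eq_matI)
  note carrier = kronecker_jordan_carrier KMS_mat_carrier[OF A, of m]
  fix p q assume "p < dim_row (?N + ?N * ?K)" "q < dim_col (?N + ?N * ?K)"
  then have p: "p < m * n" and q: "q < m * n" using carrier by auto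
  from p have n: "n > 0" by (cases n) auto
  let ?i = "p div n" and ?j = "q div n"
  let ?r = "p mod n" and ?s = "q mod n"
  have j: "?j < m" using q by (simp add: less_mult_imp_div_less)
  have rs: "?r < n" "?s < n" using n by simp_all
  have K: "?K $$ (Suc ?i * n + u, q) =
      (if Suc ?i < ?j then (A ^\<^sub>m (?j - Suc ?i)) $$ (u, ?s) else 0)" if "u < n" "Suc ?i < m" for u
    using KMS_mat_block[OF A that(2) j that(1) rs(2)] by simp
  have NK: "(?N * ?K) $$ (p, q) = (if Suc ?i < ?j then (A ^\<^sub>m (?j - ?i)) $$ (?r, ?s) else 0)"
  proof (cases "Suc ?i < ?j")
    case True
    have "(?N * ?K) $$ (p, q) = (\<Sum>u<n. A $$ (?r, u) * (A ^\<^sub>m (?j - Suc ?i)) $$ (u, ?s))"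
      unfolding kronecker_jordan_mult_index[OF carrier(2) p q] using True j K by simp
    also have "\<dots> = (A * A ^\<^sub>m (?j - Suc ?i)) $$ (?r, ?s)"
      using rs A pow_carrier_mat[OF A, of "?j - Suc ?i"]
      by (auto simp: scalar_prod_def atLeast0LessThan)
    also have "A * A ^\<^sub>m (?j - Suc ?i) = A ^\<^sub>m (Suc (?j - Suc ?i))"
      by (rule mult_pow_mat[OF A])
    also have "Suc (?j - Suc ?i) = ?j - ?i" using True by simp
    finally show ?thesis using True by simp
  next
    case False
    \<comment> \<open>Either block row \<open>Suc ?i\<close> does not exist, or it is zero in block
      column \<open>?j\<close>.\<close>
    then show ?thesis
      unfolding kronecker_jordan_mult_index[OF carrier(2) p q] using K by simp
  qed
  have "(?N + ?N * ?K) $$ (p, q) = ?N $$ (p, q) + (?N * ?K) $$ (p, q)"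
    using p q carrier by auto
  also have "\<dots> = ?K $$ (p, q)"
  proof -
    \<comment> \<open>In the first case both summands vanish, in the second only \<open>?N\<close>
      contributes, in the third only \<open>?N * ?K\<close>.\<close>
    consider "?j \<le> ?i" | "?j = Suc ?i" | "Suc ?i < ?j" by linarith
    then show ?thesis
      unfolding NK kronecker_jordan_index[OF p q] KMS_index[OF p q]
      by cases (use A in auto)
  qed
  finally show "?K $$ (p, q) = (?N + ?N * ?K) $$ (p, q)" by simp
qed (use kronecker_jordan_carrier KMS_mat_carrier[OF A, of m] in auto)

end

theorem theorem4p7:
  fixes A B :: "complex mat" and m n :: nat
  assumes "m \<ge> 2" and "n \<ge> 1"
    and "A \<in> carrier_mat n n" and "B \<in> carrier_mat n n"
  shows "similar_mat (KMS_mat m A) (KMS_mat m B) \<longleftrightarrow>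
    (\<forall>k\<in>{1..m}. num_nilpotent_blocks m A k = num_nilpotent_blocks m B k)"
proof -
  note A = assms(3) and B = assms(4)
  have "similar_mat (KMS_mat m A) (KMS_mat m B) \<longleftrightarrow>
    similar_mat (kronecker_mat (jordan_block m 0) A) (kronecker_mat (jordan_block m 0) B)"
    by (rule quasi_inverse_similar_iff[OF
          kronecker_jordan_carrier[OF A] KMS_mat_carrier[OF A] KMS_quasi_inverse[OF A]
          kronecker_jordan_carrier[OF B] KMS_mat_carrier[OF B] KMS_quasi_inverse[OF B]])
  also have "\<dots> \<longleftrightarrow>
    (\<forall>k\<in>{1..m}. num_nilpotent_blocks m A k = num_nilpotent_blocks m B k)"
    unfolding num_nilpotent_blocks_def
    by (rule similar_mat_nilpotent_iff[OF
          kronecker_jordan_carrier[OF A] kronecker_jordan_nilpotent[OF A]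
          kronecker_jordan_carrier[OF B] kronecker_jordan_nilpotent[OF B]])
  finally show ?thesis .
qed

end
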